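(* For each integer $N\ge 2$ let $(X_n)_{0\le n\le N}$ be the edge-counting process of the growing random graph with $N$ vertices, and let $\xi_N:=\min\{n: X_n>0\}$, with the convention $\xi_N:=N+1$ if $X_N=0$. Then, as $N\to\infty$, $$N^{-1/3}\,\xi_N\stackrel{d}{\to}\xi,$$ where $\xi$ is a positive random variable with $\mathbb P[\xi>x]=e^{-x^3/6}$ for $x>0$ (so $\xi^3$ has the exponential distribution with mean $6$). Moreover the convergence holds with all moments: for every real $\alpha\ge 0$, $$\mathbb E\left[N^{-\alpha/3}\xi_N^\alpha\right]\to\mathbb E[\xi^\alpha]=6^{\alpha/3}\,\Gamma\left(1+\alpha/3\right).$$
   Context: Growing random graph. Fix $N$. Initially there is a pool of $N$ virtual vertices and no edges. At each step, an element is selected uniformly at random from the current pool of virtual elements (vertices and edges), removed from the pool, and declared occupied. When the $n$-th vertex becomes occupied (it is then labelled $n$), the $n-1$ edges linking it to the previously occupied vertices $1,\dots,n-1$ are added to the pool as virtual edges. Thus when there are $n$ occupied vertices and $k$ occupied edges, the pool consists of $N-n$ virtual vertices and $\binom n2-k$ virtual edges. The process continues until the pool is empty (complete graph on $N$ vertices). For $1\le n\le N$, $X_n$ is the number of occupied edges at the moment the $n$-th vertex becomes occupied; $X_0=0$. The law of $(X_n)$ depends on $N$. Equivalently, $(X_n)$ is a Markov chain with $X_0=X_1=0$ such that, for $1\le n<N$, given $X_n=k$, the increment $X_{n+1}-X_n$ is the number of black balls drawn before the first white ball when sampling uniformly without replacement from an urn with $\binom n2-k$ black and $N-n$ white balls.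 $\stackrel{d}{\to}$ denotes convergence in distribution. *)

theory Defs
  imports "HOL-Probability.Probability"
begin

(* Vertices keep their initial names 0, ..., N - 1. An edge between u and v is Edge {u, v}.
   The n-th vertex to become occupied is the n-th Vertex entry of the history. *)
datatype element = Vertex nat | Edge "nat set"

fun is_vertex :: "element \<Rightarrow> bool" where
  "is_vertex (Vertex _) = True"
| "is_vertex (Edge _) = False"

(* A state consists of the pool of virtual elements and the occupied elements, listed in
   the order in which they became occupied. *)
type_synonym state = "element set \<times> element list"

fun new_edges :: "element \<Rightarrow> element list \<Rightarrow> element set" where
  "new_edges (Vertex v) h = (\<lambda>u. Edge {u, v}) ` {u. Vertex u \<in> set h}"
| "new_edges (Edge _) h = {}"

definition initial_state :: "nat \<Rightarrow> state" where
  "initial_state N = (Vertex ` {..<N}, [])"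

definition occupy :: "state \<Rightarrow> element \<Rightarrow> state" where
  "occupy s x = (fst s - {x} \<union> new_edges x (snd s), snd s @ [x])"

definition growth_step :: "state \<Rightarrow> state pmf" where
  "growth_step s =
     (if fst s = {} then return_pmf s else map_pmf (occupy s) (pmf_of_set (fst s)))"

(* There are N + (N choose 2) elements in all and each step occupies one of them, so the
   pool is empty after exactly this number of steps. *)
definition growing_graph :: "nat \<Rightarrow> element list pmf" where
  "growing_graph N =
     map_pmf snd
       (((\<lambda>p. bind_pmf p growth_step) ^^ (N + (N choose 2))) (return_pmf (initial_state N)))"

(* The number of steps after which n vertices are occupied. *)
definition vertex_time :: "nat \<Rightarrow> element list \<Rightarrow> nat" where
  "vertex_time n h = (LEAST t. length (filter is_vertex (take t h)) = n)"

(* The variable X_n, for n at most N. *)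
definition edge_count :: "nat \<Rightarrow> element list \<Rightarrow> nat" where
  "edge_count n h = length (filter (\<lambda>x. \<not> is_vertex x) (take (vertex_time n h) h))"

(* X_n is nondecreasing in n, so X_N = 0 means that X_n > 0 for no n at most N. *)
definition xi :: "nat \<Rightarrow> element list \<Rightarrow> nat" where
  "xi N h = (if edge_count N h = 0 then N + 1 else (LEAST n. n \<le> N \<and> edge_count n h > 0))"

(* A limit variable as in the theorem exists. *)
lemma limit_variable_exists:
  "\<exists>(M :: real measure) (\<xi> :: real \<Rightarrow> real).
     prob_space M \<and> \<xi> \<in> borel_measurable M \<and> (AE \<omega> in M. \<xi> \<omega> > 0) \<and>
     (\<forall>x>0. measure M {\<omega> \<in> space M. \<xi> \<omega> > x} = exp (- (x ^ 3) / 6))"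
proof -
  define M where "M = density lborel (exponential_density (1 / 6))"
  define \<xi> :: "real \<Rightarrow> real" where "\<xi> = root 3"
  interpret prob_space M
    unfolding M_def by (rule prob_space_exponential_density) simp
  have D: "distributed M lborel (\<lambda>x. x) (exponential_density (1 / 6))"
    by (auto simp: distributed_def M_def distr_id2 intro!: distr_id2)
  have meas: "\<xi> \<in> borel_measurable M"
    unfolding \<xi>_def M_def by measurable
  have tail: "measure M {\<omega> \<in> space M. \<xi> \<omega> > x} = exp (- (x ^ 3) / 6)" if "x \<ge> 0" for x
  proof -
    have "x < root 3 w \<longleftrightarrow> x ^ 3 < w" for w
      by (metis odd_numeral odd_real_root_power_cancel real_root_less_iff zero_less_numeral)
    then have "{\<omega> \<in> space M. \<xi> \<omega> > x} = {\<omega> \<in> space M. x ^ 3 < \<omega>}"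
      by (simp add: \<xi>_def)
    then show ?thesis
      using exponential_distributedD_gt[OF D, of "x ^ 3"] that by simp
  qed
  have "prob {\<omega> \<in> space M. \<xi> \<omega> > 0} = 1"
    using tail[of 0] by simp
  then have "AE \<omega> in M. \<xi> \<omega> > 0"
    using meas by (subst (asm) prob_Collect_eq_1) auto
  with meas tail prob_space_axioms show ?thesis
    by (intro exI[of _ M] exI[of _ \<xi>]) auto
qed

end

theory Submission
  imports Defs "HOL-Real_Asymp.Real_Asymp"
begin

text \<open>
  The event \<open>xi > n\<close> says that the first \<open>n\<close> elements to become occupied are all vertices. Multiplying
  the step probabilities gives, for \<open>n \<le> N\<close>, its probability as the product over \<open>i < n\<close> of
  \<open>1 / (1 + (i choose 2) / (N - i))\<close>. From \<open>exp (- a) \<le> 1 / (1 + a) \<le> exp (- a / (1 + a))\<close> the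
  product lies between the exponentials of \<open>- (n choose 3) / (N - n)\<close> and
  \<open>- (n choose 3) / (N + n\<^sup>2)\<close>. For \<open>n\<close> close to \<open>x N powr (1 / 3)\<close> both exponents tend to
  \<open>- x ^ 3 / 6\<close>, and the upper bound is also at most \<open>exp (1 - x / 96)\<close>, uniformly in \<open>N\<close>. Hence the
  formula \<open>E Y powr \<alpha> = \<integral>t\<ge>0. P (Y powr \<alpha> > t)\<close> and dominated convergence yield the moments.
\<close>

subsection \<open>The law of the first positive edge count\<close>

definition pool :: "nat \<Rightarrow> element list \<Rightarrow> element set" where
  "pool N h = (let V = {u. Vertex u \<in> set h} in
     Vertex ` ({..<N} - V) \<union> (Edge ` {e. e \<subseteq> V \<and> card e = 2} - set h))"

text \<open>An invariant of the process; it does not demand an admissible order of occupation. Its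
  core is that the history alone determines the virtual elements, as \<open>pool N h\<close>, so
  that they can be counted from \<open>h\<close>.\<close>

definition reachable :: "nat \<Rightarrow> state \<Rightarrow> bool" where
  "reachable N s \<longleftrightarrow> (let h = snd s; V = {u. Vertex u \<in> set h} in
     fst s = pool N h \<and> distinct h \<and> V \<subseteq> {..<N} \<and> (\<forall>e. Edge e \<in> set h \<longrightarrow> e \<subseteq> V \<and> card e = 2))"

lemma finite_pool:
  assumes "reachable N s" shows "finite (fst s)"
proof -
  have "finite {u. Vertex u \<in> set (snd s)}"
    by (rule finite_subset[of _ "{..<N}"]) (use assms in \<open>auto simp: reachable_def Let_def\<close>)
  then show ?thesis using assms by (auto simp: reachable_def pool_def Let_def)
qed

lemma reachable_initial: "reachable N (initial_state N)"
  by (auto simp: reachable_def initial_state_def pool_def card_2_iff)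

text \<open>A pair inside \<open>insert v V\<close> but not inside \<open>V\<close> must contain
  \<open>v\<close>; the pairs gained in this way are those that \<open>new_edges\<close>
  adds.\<close>

lemma pairs_insert:
  assumes "v \<notin> V"
  shows "{e. e \<subseteq> insert v V \<and> card e = 2} = {e. e \<subseteq> V \<and> card e = 2} \<union> (\<lambda>u. {u, v}) ` V"
proof -
  have "e \<in> (\<lambda>u. {u, v}) ` V" if e: "e \<subseteq> insert v V" "card e = 2" "\<not> e \<subseteq> V" for e
  proof -
    from e(2) obtain a b where "e = {a, b}" "a \<noteq> b" by (auto simp: card_2_iff)
    then show ?thesis using e(1,3) by auto
  qed
  moreover have "card {u, v} = 2" if "u \<in> V" for u
    using that assms by (auto simp: card_2_iff)
  ultimately show ?thesis by auto
qed

text \<open>Occupying an edge leaves \<open>V\<close> unchanged and only moves that edge from the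
  pool to the history. Occupying a vertex \<open>v\<close> enlarges the family of pairs, by
  \<open>pairs_insert\<close>, by precisely the new edges.\<close>

lemma reachable_occupy:
  assumes "reachable N s" "x \<in> fst s"
  shows "reachable N (occupy s x)"
proof -
  define h where "h = snd s"
  define V where "V = {u. Vertex u \<in> set h}"
  have s: "fst s = pool N h" and d: "distinct h" and V: "V \<subseteq> {..<N}"
    and E: "\<And>e. Edge e \<in> set h \<Longrightarrow> e \<subseteq> V \<and> card e = 2"
    using assms(1) by (auto simp: reachable_def Let_def h_def V_def)
  have notin: "x \<notin> set h"
    using assms(2) by (auto simp: s pool_def Let_def)
  show ?thesis
  proof (cases x)
    case (Vertex v)
    have v: "v < N" "v \<notin> V" using assms(2) Vertex by (auto simp: s pool_def V_def Let_def)
    have V': "{u. Vertex u \<in> set (h @ [x])} = insert v V"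
      by (auto simp: V_def Vertex)
    \<comment> \<open>Occupied edges join vertices of \<open>V\<close>, and \<open>v\<close> is not
      among them, so every new edge is still virtual.\<close>
    have ne: "Edge {u, v} \<notin> set h" for u
      using E[of "{u,v}"] v(2) by auto
    have "pool N h - {x} \<union> new_edges x h = pool N (h @ [x])"
    proof -
      let ?P = "Edge ` {e. e \<subseteq> V \<and> card e = 2}"
      have new: "new_edges x h = Edge ` (\<lambda>u. {u, v}) ` V"
        by (simp add: Vertex V_def image_image)
      have "Edge ` {e. e \<subseteq> insert v V \<and> card e = 2} - set (h @ [x]) = (?P - set h) \<union> new_edges x h"
        unfolding pairs_insert[OF v(2)] new image_Un using ne by (auto simp: Vertex)
      moreover have "Vertex ` ({..<N} - insert v V) = Vertex ` ({..<N} - V) - {x}"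
        by (auto simp: Vertex)
      moreover have "x \<notin> ?P" by (auto simp: Vertex)
      ultimately show ?thesis
        unfolding pool_def Let_def V' V_def[symmetric] by blast
    qed
    moreover have "e \<subseteq> insert v V \<and> card e = 2" if "Edge e \<in> set (h @ [x])" for e
      using that E[of e] Vertex by auto
    ultimately show ?thesis
      using notin d V v
      unfolding reachable_def occupy_def Let_def snd_conv fst_conv h_def[symmetric] V' s by auto
  next
    case (Edge e)
    have e: "e \<subseteq> V" "card e = 2" using assms(2) Edge by (auto simp: s pool_def V_def Let_def)
    have V': "{u. Vertex u \<in> set (h @ [x])} = V"
      by (auto simp: V_def Edge)
    have "pool N h - {x} \<union> new_edges x h = pool N (h @ [x])"
      unfolding pool_def Let_def V' using Edge by (auto simp: V_def)
    moreover have "e \<subseteq> V \<and> card e = 2" if "Edge e \<in> set (h @ [x])" for e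
      using that E[of e] Edge e by auto
    ultimately show ?thesis
      using notin d V
      unfolding reachable_def occupy_def Let_def snd_conv fst_conv h_def[symmetric] V' s by auto
  qed
qed

text \<open>With an empty pool the history lists all \<open>N\<close> vertices and all pairs of
  them; since it is \<open>distinct\<close>, its length is the number of these elements.\<close>

lemma reachable_full:
  assumes "reachable N s" "fst s = {}"
  shows "length (snd s) = N + (N choose 2)" "{u. Vertex u \<in> set (snd s)} = {..<N}"
proof -
  define h where "h = snd s"
  define V where "V = {u. Vertex u \<in> set h}"
  have s: "fst s = pool N h" and d: "distinct h" and V: "V \<subseteq> {..<N}"
    and E: "\<And>e. Edge e \<in> set h \<Longrightarrow> e \<subseteq> V \<and> card e = 2"
    using assms(1) by (auto simp: reachable_def Let_def h_def V_def)
  have *: "V = {..<N}" using V s assms(2) by (auto simp: pool_def Let_def V_def)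
  then show "{u. Vertex u \<in> set (snd s)} = {..<N}" by (simp add: V_def h_def)
  have "x \<in> Vertex ` {..<N} \<union> Edge ` {e. e \<subseteq> {..<N} \<and> card e = 2}" if "x \<in> set h" for x
  proof (cases x)
    case (Vertex v)
    then have "v \<in> V" using that by (simp add: V_def)
    then show ?thesis using * Vertex by auto
  qed (use that E * in auto)
  moreover have "Edge e \<in> set h" if "e \<subseteq> {..<N}" "card e = 2" for e
    using s assms(2) that unfolding pool_def Let_def V_def[symmetric] * by auto
  ultimately have "set h = Vertex ` {..<N} \<union> Edge ` {e. e \<subseteq> {..<N} \<and> card e = 2}"
    using * by (auto simp: V_def)
  moreover have "card (Vertex ` {..<N} \<union> Edge ` {e. e \<subseteq> {..<N} \<and> card e = 2}) = N + (N choose 2)"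
    by (subst card_Un_disjoint) (auto simp: card_image inj_on_def n_subsets)
  ultimately show "length (snd s) = N + (N choose 2)"
    using distinct_card[OF d] by (simp add: h_def)
qed

section \<open>Law of the state after a given number of steps\<close>

definition state_after :: "nat \<Rightarrow> nat \<Rightarrow> state pmf" where
  "state_after N k = ((\<lambda>p. bind_pmf p growth_step) ^^ k) (return_pmf (initial_state N))"

lemma state_after_0: "state_after N 0 = return_pmf (initial_state N)"
  and state_after_Suc: "state_after N (Suc k) = bind_pmf (state_after N k) growth_step"
  by (simp_all add: state_after_def)

text \<open>\<open>growth_step\<close> stalls on an empty pool. Before each step considered here,
  fewer than \<open>N + (N choose 2)\<close> elements are occupied, so by
  \<open>reachable_full\<close> the pool is not empty and the step appends one element.\<close>

lemma reachable_state_after: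
  assumes "s \<in> set_pmf (state_after N k)" "k \<le> N + (N choose 2)"
  shows "reachable N s \<and> length (snd s) = k"
  using assms
proof (induction k arbitrary: s)
  case 0
  then show ?case by (simp add: state_after_0 reachable_initial) (simp add: initial_state_def)
next
  case (Suc k)
  then obtain r where r: "r \<in> set_pmf (state_after N k)" "s \<in> set_pmf (growth_step r)"
    by (auto simp: state_after_Suc)
  have R: "reachable N r" "length (snd r) = k" using Suc.IH[OF r(1)] Suc.prems by auto
  then have "fst r \<noteq> {}" using reachable_full(1)[of N r] Suc.prems by auto
  with r(2) finite_pool[OF R(1)] obtain x where "x \<in> fst r" "s = occupy r x"
    by (auto simp: growth_step_def)
  with R show ?case using reachable_occupy by (auto simp: occupy_def)
qed

text \<open>The length condition keeps out shorter histories, for which \<open>take n h\<close> is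
  all of \<open>h\<close>.\<close>

definition vertices_first :: "nat \<Rightarrow> element list set" where
  "vertices_first n = {h. n \<le> length h \<and> (\<forall>x\<in>set (take n h). is_vertex x)}"

text \<open>The factor with index \<open>i\<close> is the conditional probability that a vertex
  comes next when \<open>i\<close> vertices and no edges are occupied.\<close>

definition vertices_first_prob :: "nat \<Rightarrow> nat \<Rightarrow> real" where
  "vertices_first_prob N n = (\<Prod>i<n. real (N - i) / real (N - i + (i choose 2)))"

text \<open>A history made of vertices alone leaves every pair of occupied vertices virtual.\<close>

lemma all_vertices_pool:
  assumes "reachable N s" "snd s \<in> vertices_first n" "length (snd s) = n"
  shows "card (fst s) = N - n + (n choose 2)" "card {x \<in> fst s. is_vertex x} = N - n"
proof -
  define h where "h = snd s"
  define V where "V = {u. Vertex u \<in> set h}"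
  have s: "fst s = pool N h" and d: "distinct h" and V: "V \<subseteq> {..<N}"
    using assms(1) by (auto simp: reachable_def Let_def h_def V_def)
  have fin: "finite V" using V finite_subset by blast
  have all: "is_vertex x" if "x \<in> set h" for x
    using assms(2,3) that by (auto simp: vertices_first_def h_def)
  have "set h = Vertex ` V"
  proof -
    have "x \<in> Vertex ` V" if "x \<in> set h" for x
      using all[OF that] that by (cases x) (auto simp: V_def)
    then show ?thesis by (auto simp: V_def)
  qed
  then have cV: "card V = n" using distinct_card[OF d] assms(3)
    by (simp add: h_def card_image inj_on_def)
  have pool: "fst s = Vertex ` ({..<N} - V) \<union> Edge ` {e. e \<subseteq> V \<and> card e = 2}"
    unfolding s pool_def Let_def V_def[symmetric] using all by force
  have cc: "card ({..<N} - V) = N - n" using V fin cV by (simp add: card_Diff_subset)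
  show "card (fst s) = N - n + (n choose 2)" unfolding pool
    by (subst card_Un_disjoint) (auto simp: card_image inj_on_def n_subsets fin cc cV)
  have "{x \<in> fst s. is_vertex x} = Vertex ` ({..<N} - V)"
    unfolding pool by auto
  then show "card {x \<in> fst s. is_vertex x} = N - n"
    by (simp add: card_image inj_on_def cc)
qed

lemma measure_bind_pmf:
  "measure (measure_pmf (bind_pmf p f)) A = (\<integral>x. measure (measure_pmf (f x)) A \<partial>measure_pmf p)"
  unfolding measure_pmf_bind
  by (subst measure_pmf.measure_bind[where N="count_space UNIV"])
     (auto simp: measure_subprob)

lemma vertices_first_Suc:
  assumes "length h = n"
  shows "h @ [x] \<in> vertices_first (Suc n) \<longleftrightarrow> h \<in> vertices_first n \<and> is_vertex x"
  using assms by (auto simp: vertices_first_def)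

text \<open>Induction on the number of steps, each contributing one conditional probability. After
  exactly \<open>n\<close> steps the event constrains the whole history, so
  \<open>all_vertices_pool\<close> applies.\<close>

lemma prob_vertices_first_state_after:
  assumes "n \<le> N"
  shows "measure (measure_pmf (state_after N n)) (snd -` vertices_first n) = vertices_first_prob N n"
  using assms
proof (induction n)
  case 0
  then show ?case by (simp add: state_after_0 vertices_first_prob_def vertices_first_def)
next
  case (Suc n)
  define c where "c = real (N - n) / real (N - n + (n choose 2))"
  \<comment> \<open>The one-step probability is \<open>c\<close> on the current event and 0 off it,
    so integrating over the current state multiplies the probability by \<open>c\<close>.\<close>
  have step: "measure (measure_pmf (growth_step s)) (snd -` vertices_first (Suc n)) =
      c * indicator (snd -` vertices_first n) s"
    if "s \<in> set_pmf (state_after N n)" for s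
  proof -
    have R: "reachable N s" "length (snd s) = n"
      using reachable_state_after[OF that] Suc.prems by auto
    have ne: "fst s \<noteq> {}" using reachable_full(1)[OF R(1)] R(2) Suc.prems by auto
    have fin: "finite (fst s)" using finite_pool[OF R(1)] .
    have "measure (measure_pmf (growth_step s)) (snd -` vertices_first (Suc n)) =
       measure (measure_pmf (pmf_of_set (fst s))) {x. snd s \<in> vertices_first n \<and> is_vertex x}"
      using ne by (simp add: growth_step_def vimage_def occupy_def vertices_first_Suc[OF R(2)])
    also have "\<dots> = c * indicator (snd -` vertices_first n) s"
    proof (cases "snd s \<in> vertices_first n")
      case True
      then have "measure (measure_pmf (pmf_of_set (fst s))) {x. snd s \<in> vertices_first n \<and> is_vertex x}
          = card {x \<in> fst s. is_vertex x} / card (fst s)"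
        by (subst measure_pmf_of_set[OF ne fin]) (simp add: Int_def)
      then show ?thesis
        using all_vertices_pool[OF R(1) True R(2)] True by (simp add: c_def)
    next
      case False
      then show ?thesis by simp
    qed
    finally show ?thesis .
  qed
  have "measure (measure_pmf (state_after N (Suc n))) (snd -` vertices_first (Suc n))
     = (\<integral>s. c * indicator (snd -` vertices_first n) s \<partial>measure_pmf (state_after N n))"
    unfolding state_after_Suc measure_bind_pmf using step
    by (intro integral_cong_AE) (auto simp: AE_measure_pmf_iff)
  also have "\<dots> = c * vertices_first_prob N n"
    using Suc by simp
  finally show ?case
    by (simp add: vertices_first_prob_def c_def mult.commute)
qed

text \<open>The event depends only on the first \<open>n\<close> entries of the history, and later
  steps only append; its probability is therefore unchanged through the \<open>d\<close> additional
  steps up to the complete graph.\<close>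

lemma prob_vertices_first:
  assumes "n \<le> N"
  shows "measure (measure_pmf (growing_graph N)) (vertices_first n) = vertices_first_prob N n"
proof -
  have "measure (measure_pmf (state_after N (n + d))) (snd -` vertices_first n) = vertices_first_prob N n"
    if "n + d \<le> N + (N choose 2)" for d
    using that
  proof (induction d)
    case 0
    then show ?case using prob_vertices_first_state_after[OF assms] by simp
  next
    case (Suc d)
    have step: "measure (measure_pmf (growth_step s)) (snd -` vertices_first n) =
        indicator (snd -` vertices_first n) s"
      if "s \<in> set_pmf (state_after N (n + d))" for s
    proof -
      have R: "reachable N s" "length (snd s) = n + d"
        using reachable_state_after[OF that] Suc.prems by auto
      have ne: "fst s \<noteq> {}" using reachable_full(1)[OF R(1)] R(2) Suc.prems by auto
      have "snd s @ [x] \<in> vertices_first n \<longleftrightarrow> snd s \<in> vertices_first n" for x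
        using R(2) by (simp add: vertices_first_def)
      then show ?thesis
        using ne by (auto simp: growth_step_def vimage_def occupy_def indicator_def)
    qed
    have "measure (measure_pmf (state_after N (n + Suc d))) (snd -` vertices_first n)
       = (\<integral>s. indicator (snd -` vertices_first n) s \<partial>measure_pmf (state_after N (n + d)))"
      unfolding add_Suc_right state_after_Suc measure_bind_pmf using step
      by (intro integral_cong_AE) (auto simp: AE_measure_pmf_iff)
    then show ?case using Suc by simp
  qed
  from this[of "N + (N choose 2) - n"] assms show ?thesis
    by (simp add: growing_graph_def state_after_def)
qed

section \<open>Complete histories and the variable \<open>xi\<close>\<close>

lemma growing_graph_history:
  assumes "h \<in> set_pmf (growing_graph N)"
  shows "length h = N + (N choose 2)" "N \<le> length (filter is_vertex h)"
proof -
  obtain s where "s \<in> set_pmf (state_after N (N + (N choose 2)))" and h: "h = snd s"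
    using assms by (auto simp: growing_graph_def state_after_def)
  then have R: "reachable N s" "length h = N + (N choose 2)"
    using reachable_state_after[of s N] by auto
  \<comment> \<open>\<open>reachable_full\<close> says that an empty pool forces this length.
    Conversely, one more occupation would produce a distinct history longer than the number of all
    elements.\<close>
  have "fst s = {}"
  proof (rule ccontr)
    assume "fst s \<noteq> {}"
    then obtain x where x: "x \<in> fst s" by auto
    define r where "r = occupy s x"
    have r: "reachable N r" "length (snd r) > N + (N choose 2)"
      using reachable_occupy[OF R(1) x] R(2) by (auto simp: r_def occupy_def h)
    have "y \<in> Vertex ` {..<N} \<union> Edge ` {e. e \<subseteq> {..<N} \<and> card e = 2}" if "y \<in> set (snd r)" for y
      using r(1) that by (cases y) (fastforce simp: reachable_def Let_def)+
    then have "card (set (snd r)) \<le> card (Vertex ` {..<N} \<union> Edge ` {e. e \<subseteq> {..<N} \<and> card e = 2})"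
      by (intro card_mono) auto
    also have "\<dots> = N + (N choose 2)"
      by (subst card_Un_disjoint) (auto simp: card_image inj_on_def n_subsets)
    finally show False using r by (simp add: reachable_def Let_def distinct_card)
  qed
  then have "Vertex ` {..<N} \<subseteq> set (filter is_vertex h)"
    unfolding reachable_full(2)[OF R(1) \<open>fst s = {}\<close>, symmetric] h by auto
  then have "card (Vertex ` {..<N}) \<le> card (set (filter is_vertex h))"
    by (intro card_mono) auto
  also have "\<dots> \<le> length (filter is_vertex h)" by (rule card_length)
  finally show "N \<le> length (filter is_vertex h)" by (simp add: card_image inj_on_def)
  show "length h = N + (N choose 2)" by (rule R(2))
qed

text \<open>When the \<open>m\<close>-th vertex arrives, the prefix consists of \<open>m\<close>
  vertices and \<open>edge_count m h\<close> edges, so the absence of edges means that it has length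
  \<open>m\<close>. The hypothesis makes the \<open>LEAST\<close> in \<open>vertex_time\<close>
  meaningful.\<close>

lemma edge_count_eq_0_iff:
  assumes "m \<le> length (filter is_vertex h)"
  shows "edge_count m h = 0 \<longleftrightarrow> h \<in> vertices_first m"
proof -
  let ?f = "\<lambda>t. length (filter is_vertex (take t h))"
  \<comment> \<open>Discrete intermediate values: the vertex count of a prefix changes by at most
    one per step, so it attains \<open>m\<close>.\<close>
  have "\<bar>int (?f (Suc t)) - int (?f t)\<bar> \<le> 1" for t
    by (cases "t < length h") (auto simp: take_Suc_conv_app_nth)
  then have "\<exists>t. 0 \<le> t \<and> t \<le> length h \<and> int (?f t) = int m"
    using assms by (intro nat_intermed_int_val) auto
  then have ex: "\<exists>t. ?f t = m" by auto
  define \<tau> where "\<tau> = vertex_time m h"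
  have \<tau>: "?f \<tau> = m" "\<And>t. ?f t = m \<Longrightarrow> \<tau> \<le> t"
    using LeastI_ex[OF ex] Least_le[of "\<lambda>t. ?f t = m"] by (auto simp: \<tau>_def vertex_time_def)
  have len: "m \<le> length h" using assms length_filter_le le_trans by blast
  have count: "edge_count m h = length (take \<tau> h) - m"
    using sum_length_filter_compl[of is_vertex "take \<tau> h"] \<tau>(1)
    unfolding edge_count_def \<tau>_def[symmetric] by linarith
  show ?thesis
  proof
    assume "edge_count m h = 0"
    then have L: "length (take \<tau> h) \<le> m" using count by auto
    then have "length (filter is_vertex (take \<tau> h)) = length (take \<tau> h)"
      using \<tau>(1) length_filter_le[of is_vertex "take \<tau> h"] by auto
    then have all: "\<forall>x\<in>set (take \<tau> h). is_vertex x"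
      by (metis filter_id_conv length_filter_less less_irrefl)
    \<comment> \<open>The prefix has length exactly \<open>m\<close>: either
      \<open>\<tau> = m\<close>, or formally \<open>\<tau>\<close> lies beyond the end of
      \<open>h\<close> and both prefixes are \<open>h\<close>.\<close>
    have "take m h = take \<tau> h"
      using L \<tau>(1) length_filter_le[of is_vertex "take \<tau> h"] by (cases "\<tau> \<le> length h") auto
    with all len show "h \<in> vertices_first m" by (simp add: vertices_first_def)
  next
    assume "h \<in> vertices_first m"
    then have "?f m = m" by (simp add: vertices_first_def)
    then have "\<tau> \<le> m" by (rule \<tau>(2))
    then show "edge_count m h = 0" by (simp add: count)
  qed
qed

lemma vertices_first_mono: "m \<le> n \<Longrightarrow> vertices_first n \<subseteq> vertices_first m"
  unfolding vertices_first_def by (auto dest: set_mp[OF set_take_subset_set_take])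

text \<open>Since \<open>vertices_first\<close> shrinks as its index grows, the least index with a
  positive count exceeds \<open>n\<close> iff the count at \<open>n\<close> is still 0. The default
  \<open>N + 1\<close> lies above every \<open>n \<le> N\<close>, in accordance with
  \<open>edge_count N h = 0\<close>.\<close>

lemma
  assumes "h \<in> set_pmf (growing_graph N)"
  shows xi_greater_iff: "n \<le> N \<Longrightarrow> n < xi N h \<longleftrightarrow> h \<in> vertices_first n"
    and xi_le: "xi N h \<le> N + 1"
proof -
  have count: "edge_count m h = 0 \<longleftrightarrow> h \<in> vertices_first m" if "m \<le> N" for m
    using edge_count_eq_0_iff growing_graph_history[OF assms] that by auto
  show "n < xi N h \<longleftrightarrow> h \<in> vertices_first n" if n: "n \<le> N"
  proof (cases "edge_count N h = 0")
    case True
    then show ?thesis using count[of N] vertices_first_mono[OF n] n by (auto simp: xi_def)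
  next
    case False
    let ?P = "\<lambda>n. n \<le> N \<and> edge_count n h > 0"
    have P: "?P (xi N h)" using False LeastI[of ?P N] by (simp add: xi_def)
    have "\<not> ?P k" if "k < xi N h" for k
      using not_less_Least[of k ?P] that False by (simp add: xi_def)
    with P show ?thesis using count n vertices_first_mono
      by (metis (no_types, lifting) gr0I less_irrefl linorder_not_less subsetD)
  qed
  show "xi N h \<le> N + 1"
    using Least_le[of "\<lambda>n. n \<le> N \<and> edge_count n h > 0" N] by (auto simp: xi_def)
qed

lemma xi_pos: "h \<in> set_pmf (growing_graph N) \<Longrightarrow> 0 < xi N h"
  using xi_greater_iff[of h N 0] by (simp add: vertices_first_def)

text \<open>\<open>xi\<close> is at most \<open>N + 1\<close>, hence the value 0 for
  \<open>n > N\<close>.\<close>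

lemma xi_tail:
  "measure (measure_pmf (growing_graph N)) {h. n < xi N h} =
     (if n \<le> N then vertices_first_prob N n else 0)"
proof -
  have "measure (measure_pmf (growing_graph N)) {h. n < xi N h} =
        measure (measure_pmf (growing_graph N)) (if n \<le> N then vertices_first n else {})"
    using xi_greater_iff xi_le by (intro measure_pmf.finite_measure_eq_AE) (fastforce simp: AE_measure_pmf_iff)+
  then show ?thesis using prob_vertices_first by auto
qed

subsection \<open>Estimates for the product\<close>

text \<open>The sum is \<open>n choose 3\<close>, written as a real polynomial for the estimates
  below.\<close>

lemma sum_choose_two: "(\<Sum>i<n. real (i choose 2)) = real n * (real n - 1) * (real n - 2) / 6"
proof (induction n)
  case (Suc n)
  have "real (n choose 2) = real n * (real n - 1) / 2"
    by (cases n) (simp_all add: choose_two real_of_nat_div algebra_simps)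
  with Suc show ?case by (simp add: field_simps)
qed simp

text \<open>With \<open>a = (i choose 2) / (N - i)\<close> each factor is
  \<open>1 / (1 + a)\<close>, and \<open>1 + a \<le> exp a\<close> bounds it below by
  \<open>exp (- a)\<close>. Replacing \<open>N - i\<close> by the smaller \<open>N - n\<close> gives
  all exponents the same denominator.\<close>

lemma vertices_first_prob_lower:
  assumes "n < N"
  shows "exp (- (real n ^ 3 / 6) / (real N - real n)) \<le> vertices_first_prob N n"
proof -
  have "exp (- (real (i choose 2) / (real N - real n))) \<le> real (N - i) / real (N - i + (i choose 2))"
    if "i < n" for i
  proof -
    define a where "a = real (i choose 2) / real (N - i)"
    have pos: "real (N - i) > 0" "real (N - i) \<ge> real N - real n" "real N - real n > 0"
      using that assms by auto
    have "exp (- (real (i choose 2) / (real N - real n))) \<le> exp (- a)"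
      using pos by (auto simp: a_def intro!: divide_left_mono)
    also have "\<dots> \<le> 1 / (1 + a)"
      using exp_ge_add_one_self[of a] pos
      by (auto simp: exp_minus inverse_eq_divide a_def intro!: divide_left_mono mult_pos_pos add_pos_nonneg)
    also have "\<dots> = real (N - i) / real (N - i + (i choose 2))"
      using pos by (simp add: a_def field_simps)
    finally show ?thesis .
  qed
  then have "(\<Prod>i<n. exp (- (real (i choose 2) / (real N - real n)))) \<le> vertices_first_prob N n"
    unfolding vertices_first_prob_def by (intro prod_mono) auto
  moreover have "(\<Prod>i<n. exp (- (real (i choose 2) / (real N - real n)))) =
      exp (- ((\<Sum>i<n. real (i choose 2)) / (real N - real n)))"
    by (simp add: exp_sum[symmetric] sum_negf sum_divide_distrib)
  moreover have "(\<Sum>i<n. real (i choose 2)) \<le> real n ^ 3 / 6"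
  proof (cases n)
    case (Suc m)
    \<comment> \<open>For \<open>n = Suc m\<close> the difference of the two sides is
      \<open>3 * m ^ 2 + 4 * m + 1\<close>, without negative coefficients.\<close>
    have "real n * (real n - 1) * (real n - 2) \<le> real n * real n * real n"
      unfolding Suc by (simp add: algebra_simps)
    then show ?thesis by (simp add: sum_choose_two power3_eq_cube)
  qed simp
  then have "exp (- (real n ^ 3 / 6) / (real N - real n)) \<le>
      exp (- ((\<Sum>i<n. real (i choose 2)) / (real N - real n)))"
    using assms by (simp only: exp_le_cancel_iff minus_divide_left[symmetric] neg_le_iff_le) (intro divide_right_mono, auto)
  ultimately show ?thesis by linarith
qed

text \<open>Each factor has the form \<open>1 - u\<close> and is at most \<open>exp (- u)\<close>,
  where the denominator of \<open>u\<close> is at most \<open>N + n ^ 2\<close>. As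
  \<open>2 \<le> n\<close>, the nonnegative number \<open>n - 2\<close> bounds all three factors of
  the sum formula from below.\<close>

lemma vertices_first_prob_upper:
  assumes "n \<le> N" "2 \<le> n"
  shows "vertices_first_prob N n \<le> exp (- ((real n - 2) ^ 3 / 6) / (real N + real n ^ 2))"
proof -
  let ?D = "real N + real n ^ 2"
  have D: "?D > 0" using assms by (auto intro!: add_pos_nonneg)
  have "real (N - i) / real (N - i + (i choose 2)) \<le> exp (- (real (i choose 2) / ?D))"
    if "i < n" for i
  proof -
    have "i choose 2 \<le> n ^ 2"
    proof -
      have "i choose 2 \<le> i ^ 2" by (simp add: choose_two power2_eq_square) (metis diff_le_self div_le_dividend le_trans mult_le_mono2)
      also have "\<dots> \<le> n ^ 2" using that by (intro power_mono) auto
      finally show ?thesis .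
    qed
    then have le: "real (N - i + (i choose 2)) \<le> ?D"
      by (metis (mono_tags, lifting) add_mono diff_le_self of_nat_add of_nat_le_iff of_nat_power)
    have pos: "real (N - i + (i choose 2)) > 0" using that assms by auto
    have "real (N - i) / real (N - i + (i choose 2)) =
        1 + - (real (i choose 2) / real (N - i + (i choose 2)))"
      using pos by (simp add: field_simps)
    also have "\<dots> \<le> exp (- (real (i choose 2) / real (N - i + (i choose 2))))"
      by (rule exp_ge_add_one_self)
    also have "\<dots> \<le> exp (- (real (i choose 2) / ?D))"
      using le pos D by (auto intro!: divide_left_mono mult_pos_pos)
    finally show ?thesis .
  qed
  then have "vertices_first_prob N n \<le> (\<Prod>i<n. exp (- (real (i choose 2) / ?D)))"
    unfolding vertices_first_prob_def by (intro prod_mono) auto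
  also have "\<dots> = exp (- ((\<Sum>i<n. real (i choose 2)) / ?D))"
    by (simp add: exp_sum[symmetric] sum_negf sum_divide_distrib)
  also have "\<dots> \<le> exp (- ((real n - 2) ^ 3 / 6) / ?D)"
  proof -
    have "(real n - 2) * (real n - 2) * (real n - 2) \<le> real n * (real n - 1) * (real n - 2)"
      using assms by (intro mult_mono) auto
    then have "(real n - 2) ^ 3 / 6 \<le> (\<Sum>i<n. real (i choose 2))"
      by (simp add: sum_choose_two power3_eq_cube)
    then show ?thesis using D
      by (simp only: exp_le_cancel_iff minus_divide_left[symmetric] neg_le_iff_le) (intro divide_right_mono, auto)
  qed
  finally show ?thesis .
qed

text \<open>A sandwich between the two exponential bounds, with \<open>n\<close> the floor of
  \<open>y N\<close>. Both \<open>y N\<close> and \<open>y N ^ 2\<close> are negligible against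
  \<open>N\<close>, so both exponents tend to \<open>- (x ^ 3) / 6\<close>.\<close>

lemma vertices_first_prob_limit:
  assumes "x > 0"
  shows "(\<lambda>N. let n = nat \<lfloor>x * real N powr (1 / 3)\<rfloor> in if n \<le> N then vertices_first_prob N n else 0)
    \<longlonglongrightarrow> exp (- (x ^ 3) / 6)"
proof -
  define y where "y = (\<lambda>N::nat. x * real N powr (1 / 3))"
  define n where "n = (\<lambda>N. nat \<lfloor>y N\<rfloor>)"
  have n: "y N - 1 \<le> real (n N)" "real (n N) \<le> y N" for N
    using assms by (auto simp: n_def y_def)
  \<comment> \<open>\<open>y N < N\<close> keeps \<open>n N\<close> below \<open>N\<close>;
    \<open>y N > 4\<close> gives \<open>2 \<le> n N\<close> and makes \<open>y N - 3\<close>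
    positive.\<close>
  have ev1: "\<forall>\<^sub>F N in sequentially. y N < real N" "\<forall>\<^sub>F N in sequentially. y N > 4"
    unfolding y_def using assms by real_asymp+
  \<comment> \<open>The shift by 3 is the 2 of \<open>n - 2\<close> plus the 1 lost to the
    floor.\<close>
  have lim: "(\<lambda>N. exp (- (y N ^ 3 / 6) / (real N - y N))) \<longlonglongrightarrow> exp (- (x ^ 3) / 6)"
    "(\<lambda>N. exp (- ((y N - 3) ^ 3 / 6) / (real N + y N ^ 2))) \<longlonglongrightarrow> exp (- (x ^ 3) / 6)"
    unfolding y_def using assms
    by (real_asymp simp: field_simps power3_eq_cube)+
  have "(\<lambda>N. if n N \<le> N then vertices_first_prob N (n N) else 0) \<longlonglongrightarrow> exp (- (x ^ 3) / 6)"
  proof (rule tendsto_sandwich[OF _ _ lim])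
    show "\<forall>\<^sub>F N in sequentially. exp (- (y N ^ 3 / 6) / (real N - y N)) \<le>
       (if n N \<le> N then vertices_first_prob N (n N) else 0)"
      using ev1
    proof eventually_elim
      case (elim N)
      have nN: "n N < N" using n(2)[of N] elim by linarith
      have "real (n N) ^ 3 / 6 / (real N - real (n N)) \<le> y N ^ 3 / 6 / (real N - y N)"
        using n(2)[of N] elim by (intro frac_le divide_right_mono power_mono) auto
      then show ?case using vertices_first_prob_lower[OF nN] nN
        by (auto intro: order_trans[rotated])
    qed
    show "\<forall>\<^sub>F N in sequentially. (if n N \<le> N then vertices_first_prob N (n N) else 0) \<le>
        exp (- ((y N - 3) ^ 3 / 6) / (real N + y N ^ 2))"
      using ev1
    proof eventually_elim
      case (elim N)
      have nN: "n N < N" "2 \<le> n N" using n[of N] elim by linarith+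
      have "(y N - 3) ^ 3 / 6 / (real N + y N ^ 2) \<le> (real (n N) - 2) ^ 3 / 6 / (real N + real (n N) ^ 2)"
        using n[of N] elim nN by (intro frac_le divide_right_mono power_mono add_mono add_pos_nonneg) auto
      then show ?case using vertices_first_prob_upper[of "n N" N] nN
        by (auto intro: order_trans)
    qed
  qed
  then show ?thesis unfolding n_def y_def Let_def .
qed

section \<open>Uniform exponential tail bound\<close>

lemma vertices_first_prob_le_1: "vertices_first_prob N n \<le> 1"
  unfolding vertices_first_prob_def by (intro prod_le_1) (auto simp: divide_le_eq_1)

text \<open>Uniform in \<open>N\<close>, for use in dominated convergence. For \<open>x < 6\<close>
  the exponent is positive and the bound trivial. Otherwise 96 is \<open>6 * 8 * 2\<close>: 6 from
  the upper estimate, 8 from cubing \<open>real n - 2 \<ge> y / 2\<close>, and 2 from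
  \<open>1 + x ^ 2 \<le> 2 * x ^ 2\<close>.\<close>

lemma vertices_first_prob_exponential_bound:
  assumes "0 < N" "0 \<le> x" "n = nat \<lfloor>x * real N powr (1 / 3)\<rfloor>" "n \<le> N"
  shows "vertices_first_prob N n \<le> exp (1 - x / 96)"
proof (cases "x \<ge> 6")
  case False
  then have "1 \<le> exp (1 - x / 96)" by simp
  then show ?thesis using vertices_first_prob_le_1[of N n] by linarith
next
  case True
  define M where "M = real N powr (1 / 3)"
  define y where "y = x * M"
  have M: "M \<ge> 1" "M ^ 3 = real N"
    using assms(1) by (auto simp: M_def ge_one_powr_ge_zero powr_power)
  have "x * 1 \<le> y" unfolding y_def using M True by (intro mult_left_mono) auto
  then have y: "y \<ge> 6" using True by simp
  have n: "y - 1 \<le> real n" "real n \<le> y"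
    using assms(2) M by (auto simp: assms(3) y_def M_def)
  then have n2: "2 \<le> n" using y by linarith
  have pos: "M ^ 3 + y ^ 2 > 0" using M(1) by (intro add_pos_nonneg) auto
  have "x / 96 \<le> x ^ 3 / (48 * (1 + x ^ 2))"
  proof -
    have "1 + x ^ 2 \<le> 2 * x ^ 2" using True power_mono[of 1 x 2] by simp
    then have "x * (48 * (1 + x ^ 2)) \<le> x * (48 * (2 * x ^ 2))" using True by (intro mult_left_mono) auto
    then show ?thesis using True by (simp add: field_simps power2_eq_square power3_eq_cube add_pos_nonneg)
  qed
  \<comment> \<open>Expanding the fraction by \<open>M ^ 3 = N\<close> brings in
    \<open>y = x * M\<close>; the denominator then needs only
    \<open>y ^ 2 \<le> x ^ 2 * M ^ 3\<close>.\<close>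
  also have "\<dots> = (x ^ 3 * M ^ 3) / ((48 * (1 + x ^ 2)) * M ^ 3)"
    using M(1) by simp
  also have "\<dots> = (x * M) ^ 3 / (48 * (M ^ 3 + x ^ 2 * M ^ 3))"
    by (simp only: power_mult_distrib) (simp add: algebra_simps)
  also have "\<dots> \<le> y ^ 3 / (48 * (M ^ 3 + y ^ 2))"
  proof -
    have "M ^ 2 \<le> M ^ 3" using M by (intro power_increasing) auto
    then have "y ^ 2 \<le> x ^ 2 * M ^ 3" by (simp add: y_def power_mult_distrib mult_left_mono)
    then show ?thesis using pos y unfolding y_def[symmetric] by (intro divide_left_mono mult_pos_pos) auto
  qed
  also have "\<dots> = (y / 2) ^ 3 / 6 / (M ^ 3 + y ^ 2)" by (simp add: power_divide)
  \<comment> \<open>From \<open>y \<ge> 6\<close> follows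
    \<open>real n - 2 \<ge> y - 3 \<ge> y / 2\<close>, and \<open>real n \<le> y\<close> bounds the
    denominator.\<close>
  also have "\<dots> \<le> (real n - 2) ^ 3 / 6 / (real N + real n ^ 2)"
    using n y M(2) assms(1) by (intro frac_le divide_right_mono power_mono add_mono add_pos_nonneg)
      (auto simp del: of_nat_power)
  finally have "x / 96 \<le> (real n - 2) ^ 3 / 6 / (real N + real n ^ 2)" .
  then have "exp (- ((real n - 2) ^ 3 / 6) / (real N + real n ^ 2)) \<le> exp (1 - x / 96)" by simp
  then show ?thesis using vertices_first_prob_upper[OF assms(4) n2] by linarith
qed

text \<open>Supplies an integrable majorant: the stretched exponential falls below
  \<open>1 / (1 + t ^ 2)\<close> beyond some \<open>T\<close>, and monotonicity bounds the range
  before \<open>T\<close>. \<open>C\<close> adds the two constants.\<close>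

lemma exp_powr_dominated:
  fixes a c d :: real
  assumes "a > 0" "c > 0"
  shows "\<exists>C. \<forall>t\<ge>0. exp (d - c * t powr a) \<le> C / (1 + t ^ 2)"
proof -
  have "((\<lambda>t. (1 + t ^ 2) * exp (d - c * t powr a)) \<longlongrightarrow> 0) at_top"
    using assms by real_asymp
  then have "\<forall>\<^sub>F t in at_top. (1 + t ^ 2) * exp (d - c * t powr a) < 1"
    by (rule order_tendstoD) simp
  then obtain T where T: "\<And>t. t \<ge> T \<Longrightarrow> (1 + t ^ 2) * exp (d - c * t powr a) < 1"
    by (auto simp: eventually_at_top_linorder)
  define C where "C = 1 + (1 + T ^ 2) * exp d"
  have "(1 + t ^ 2) * exp (d - c * t powr a) \<le> C" if "t \<ge> 0" for t
  proof (cases "t \<ge> T")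
    case True
    have "C \<ge> 1" by (simp add: C_def)
    with T[OF True] show ?thesis by linarith
  next
    case False
    then have "(1 + t ^ 2) * exp (d - c * t powr a) \<le> (1 + T ^ 2) * exp d"
      using that assms by (intro mult_mono add_mono power_mono) auto
    then show ?thesis by (simp add: C_def)
  qed
  then show ?thesis by (auto simp: field_simps add_pos_nonneg intro!: exI[of _ C])
qed

subsection \<open>Convergence\<close>

lemma (in prob_space) borel_measurable_prob_greater:
  fixes f :: "'a \<Rightarrow> real"
  assumes [measurable]: "f \<in> borel_measurable M"
  shows "(\<lambda>t. prob {x \<in> space M. t < f x}) \<in> borel_measurable borel"
proof -
  have "mono (\<lambda>t. - prob {x \<in> space M. t < f x})"
    by (intro monoI) (auto intro!: finite_measure_mono)
  then have "(\<lambda>t. - prob {x \<in> space M. t < f x}) \<in> borel_measurable borel"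
    by (rule borel_measurable_mono)
  then have "(\<lambda>t. - (- prob {x \<in> space M. t < f x})) \<in> borel_measurable borel"
    by (rule borel_measurable_uminus)
  then show ?thesis by simp
qed

text \<open>Layer-cake formula: \<open>f x\<close> is the length of \<open>{0..<f x}\<close>, and
  Tonelli's theorem exchanges the two integrations. The equality is proved for nonnegative integrals
  and carries over to Bochner integrals, both being 0 when the value is infinite.\<close>

lemma (in prob_space) expectation_eq_integral_tail:
  fixes f :: "'a \<Rightarrow> real"
  assumes [measurable]: "f \<in> borel_measurable M" and nonneg: "\<And>x. x \<in> space M \<Longrightarrow> 0 \<le> f x"
  shows "expectation f = (\<integral>t. indicator {0..} t * prob {x \<in> space M. t < f x} \<partial>lborel)"
proof -
  interpret L: pair_sigma_finite M lborel ..
  note [measurable] = borel_measurable_prob_greater[OF assms(1)]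
  have "(\<integral>\<^sup>+x. ennreal (f x) \<partial>M) = (\<integral>\<^sup>+x. (\<integral>\<^sup>+t. indicator {t. 0 \<le> t \<and> t < f x} t \<partial>lborel) \<partial>M)"
  proof (rule nn_integral_cong)
    fix x assume "x \<in> space M"
    have "{t. 0 \<le> t \<and> t < f x} = {0..<f x}" by auto
    then show "ennreal (f x) = (\<integral>\<^sup>+t. indicator {t. 0 \<le> t \<and> t < f x} t \<partial>lborel)"
      using nonneg[OF \<open>x \<in> space M\<close>] by simp
  qed
  also have "\<dots> = (\<integral>\<^sup>+t. (\<integral>\<^sup>+x. indicator {t. 0 \<le> t \<and> t < f x} t \<partial>M) \<partial>lborel)"
    by (rule L.Fubini'[symmetric]) measurable
  also have "\<dots> = (\<integral>\<^sup>+t. ennreal (indicator {0..} t * prob {x \<in> space M. t < f x}) \<partial>lborel)"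
  proof (rule nn_integral_cong)
    fix t :: real
    have "(\<integral>\<^sup>+x. indicator {t. 0 \<le> t \<and> t < f x} t \<partial>M) =
        (\<integral>\<^sup>+x. indicator {0..} t * indicator {x \<in> space M. t < f x} x \<partial>M)"
      by (intro nn_integral_cong) (auto simp: indicator_def)
    also have "\<dots> = ennreal (indicator {0..} t * prob {x \<in> space M. t < f x})"
      by (subst nn_integral_cmult) (auto simp: emeasure_eq_measure indicator_def)
    finally show "(\<integral>\<^sup>+x. indicator {t. 0 \<le> t \<and> t < f x} t \<partial>M) =
        ennreal (indicator {0..} t * prob {x \<in> space M. t < f x})" .
  qed
  finally show ?thesis
    using nonneg by (simp add: integral_eq_nn_integral)
qed

section \<open>Tails and moments of the rescaled variable\<close>

definition rescaled_xi :: "nat \<Rightarrow> element list \<Rightarrow> real" where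
  "rescaled_xi N h = real N powr (- 1 / 3) * real (xi N h)"

text \<open>\<open>xi\<close> is an integer, so it exceeds \<open>x * N powr (1 / 3)\<close> iff it
  exceeds the floor.\<close>

lemma rescaled_xi_tail:
  assumes "0 < N" "0 \<le> x"
  shows "measure (measure_pmf (growing_graph N)) {h. x < rescaled_xi N h} =
    (let n = nat \<lfloor>x * real N powr (1 / 3)\<rfloor> in if n \<le> N then vertices_first_prob N n else 0)"
proof -
  have "x < rescaled_xi N h \<longleftrightarrow> nat \<lfloor>x * real N powr (1 / 3)\<rfloor> < xi N h" for h
  proof -
    have "x < rescaled_xi N h \<longleftrightarrow> x * real N powr (1 / 3) < real (xi N h)"
      using assms(1) by (simp add: rescaled_xi_def powr_minus field_simps)
    also have "\<dots> \<longleftrightarrow> \<lfloor>x * real N powr (1 / 3)\<rfloor> < int (xi N h)"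
      by (simp add: floor_less_iff)
    also have "\<dots> \<longleftrightarrow> nat \<lfloor>x * real N powr (1 / 3)\<rfloor> < xi N h"
      using assms(2) by (simp add: nat_less_iff)
    finally show ?thesis .
  qed
  then show ?thesis by (simp add: xi_tail Let_def)
qed

lemma rescaled_xi_tail_limit:
  assumes "x > 0"
  shows "(\<lambda>N. measure (measure_pmf (growing_graph N)) {h. x < rescaled_xi N h}) \<longlonglongrightarrow> exp (- (x ^ 3) / 6)"
proof -
  have "\<forall>\<^sub>F N in sequentially. (let n = nat \<lfloor>x * real N powr (1 / 3)\<rfloor> in
      if n \<le> N then vertices_first_prob N n else 0) =
      measure (measure_pmf (growing_graph N)) {h. x < rescaled_xi N h}"
    using eventually_gt_at_top[of 0]
    by eventually_elim (subst rescaled_xi_tail; use assms in simp)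
  then show ?thesis using vertices_first_prob_limit[OF assms] by (rule Lim_transform_eventually[rotated])
qed

lemma rescaled_xi_tail_bound:
  assumes "0 < N" "0 \<le> x"
  shows "measure (measure_pmf (growing_graph N)) {h. x < rescaled_xi N h} \<le> exp (1 - x / 96)"
  unfolding rescaled_xi_tail[OF assms] Let_def
  using vertices_first_prob_exponential_bound[OF assms refl] by (simp only: exp_ge_zero split: if_split) blast

lemma powr_greater_iff:
  fixes t y a :: real
  assumes "0 \<le> t" "0 \<le> y" "0 < a"
  shows "t < y powr a \<longleftrightarrow> t powr (1 / a) < y"
proof -
  have "t powr (1 / a) < y \<longleftrightarrow> (t powr (1 / a)) powr a < y powr a"
    using assms powr_mono2[of a y "t powr (1 / a)"] powr_less_mono2[of a "t powr (1 / a)" y]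
    by (auto simp: not_less[symmetric] simp del: powr_powr)
  then show ?thesis using assms by (simp add: powr_powr)
qed

text \<open>For \<open>t \<ge> 0\<close> the tail of the \<open>\<alpha>\<close>-th power at
  \<open>t\<close> is the tail of \<open>rescaled_xi\<close> at
  \<open>t powr (1 / \<alpha>)\<close>. These tails converge pointwise and
  \<open>exp_powr_dominated\<close> provides the majorant. The limit is left as a tail integral, to
  be matched with that of \<open>\<xi>\<close>.\<close>

lemma rescaled_xi_moment:
  assumes "0 < \<alpha>"
  shows "(\<lambda>N. measure_pmf.expectation (growing_graph N) (\<lambda>h. rescaled_xi N h powr \<alpha>)) \<longlonglongrightarrow>
     (\<integral>t. indicator {0..} t * exp (- ((t powr (1 / \<alpha>)) ^ 3) / 6) \<partial>lborel)"
proof -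
  let ?P = "\<lambda>N. measure (measure_pmf (growing_graph N))"
  define s where "s N t = indicator {0..} t * ?P N {h. t < rescaled_xi N h powr \<alpha>}" for N and t :: real
  have E: "measure_pmf.expectation (growing_graph N) (\<lambda>h. rescaled_xi N h powr \<alpha>) = integral\<^sup>L lborel (s N)" for N
    unfolding s_def by (subst measure_pmf.expectation_eq_integral_tail) auto
  have s: "s N t = indicator {0..} t * ?P N {h. t powr (1 / \<alpha>) < rescaled_xi N h}" for N t
    using assms by (auto simp: s_def indicator_def powr_greater_iff rescaled_xi_def)
  obtain C where C: "\<And>t. t \<ge> 0 \<Longrightarrow> exp (1 - 1 / 96 * t powr (1 / \<alpha>)) \<le> C / (1 + t ^ 2)"
    using exp_powr_dominated[of "1 / \<alpha>" "1 / 96" 1] assms by auto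
  have C0: "C \<ge> 0"
    using C[of 0] by (simp add: order_trans[OF exp_ge_zero])
  \<comment> \<open>The index is shifted because the tail bound is stated for positive
    \<open>N\<close>.\<close>
  have "(\<lambda>N. integral\<^sup>L lborel (s (Suc N))) \<longlonglongrightarrow>
     (\<integral>t. indicator {0..} t * exp (- ((t powr (1 / \<alpha>)) ^ 3) / 6) \<partial>lborel)"
  proof (rule integral_dominated_convergence)
    show "(\<lambda>t. indicator {0..} t * exp (- ((t powr (1 / \<alpha>)) ^ 3) / 6)) \<in> borel_measurable lborel"
      by measurable
    show "s (Suc N) \<in> borel_measurable lborel" for N
      unfolding s_def using measure_pmf.borel_measurable_prob_greater[of "\<lambda>h. rescaled_xi (Suc N) h powr \<alpha>"]
      by simp
    have "integrable lborel (\<lambda>t::real. inverse (1 + t ^ 2))"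
      using integrable_inverse_1_plus_square by (simp add: set_integrable_def einterval_def)
    then show "integrable lborel (\<lambda>t. C / (1 + t ^ 2))"
      unfolding divide_inverse by (rule integrable_mult_right)
    show "AE t in lborel. norm (s (Suc N) t) \<le> C / (1 + t ^ 2)" for N
    proof (rule AE_I2)
      fix t :: real
      show "norm (s (Suc N) t) \<le> C / (1 + t ^ 2)"
      proof (cases "t \<ge> 0")
        case True
        then have "norm (s (Suc N) t) \<le> exp (1 - 1 / 96 * t powr (1 / \<alpha>))"
          using rescaled_xi_tail_bound[of "Suc N" "t powr (1 / \<alpha>)"] by (simp add: s)
        also have "\<dots> \<le> C / (1 + t ^ 2)"
          by (rule C[OF True])
        finally show ?thesis .
      qed (use C0 in \<open>simp add: s\<close>)
    qed
    \<comment> \<open>The tail limit is available at positive arguments only, so the null set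
      \<open>t = 0\<close> is left out.\<close>
    have "AE t::real in lborel. t \<noteq> 0" by (rule AE_lborel_singleton)
    then show "AE t in lborel. (\<lambda>N. s (Suc N) t) \<longlonglongrightarrow> indicator {0..} t * exp (- ((t powr (1 / \<alpha>)) ^ 3) / 6)"
    proof eventually_elim
      case (elim t)
      show ?case unfolding s
        using elim LIMSEQ_Suc[OF rescaled_xi_tail_limit[of "t powr (1 / \<alpha>)"]]
        by (cases "t < 0") (auto intro!: tendsto_mult_left)
    qed
  qed
  then show ?thesis unfolding E by (rule LIMSEQ_imp_Suc)
qed

lemma rescaled_xi_pos:
  assumes "0 < N" "h \<in> set_pmf (growing_graph N)" shows "0 < rescaled_xi N h"
  using assms xi_pos by (simp add: rescaled_xi_def)

section \<open>The limit law and its moments\<close>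

theorem theorem1:
  fixes M :: "'a measure" and \<xi> :: "'a \<Rightarrow> real"
  assumes "prob_space M"
    and "\<xi> \<in> borel_measurable M"
    and "AE \<omega> in M. \<xi> \<omega> > 0"
    and "\<And>x::real. x > 0 \<Longrightarrow> measure M {\<omega> \<in> space M. \<xi> \<omega> > x} = exp (- (x ^ 3) / 6)"
  shows "weak_conv_m
           (\<lambda>N. distr (measure_pmf (growing_graph N)) borel
                  (\<lambda>h. real N powr (- 1 / 3) * real (xi N h)))
           (distr M borel \<xi>)
       \<and> distributed M lborel (\<lambda>\<omega>. \<xi> \<omega> ^ 3) (exponential_density (1 / 6))
       \<and> (\<forall>\<alpha>::real. \<alpha> \<ge> 0 \<longrightarrow>
            (\<lambda>N. measure_pmf.expectation (growing_graph N)
                   (\<lambda>h. real N powr (- \<alpha> / 3) * real (xi N h) powr \<alpha>))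
              \<longlonglongrightarrow> integral\<^sup>L M (\<lambda>\<omega>. \<xi> \<omega> powr \<alpha>)
          \<and> integrable M (\<lambda>\<omega>. \<xi> \<omega> powr \<alpha>)
          \<and> integral\<^sup>L M (\<lambda>\<omega>. \<xi> \<omega> powr \<alpha>) = 6 powr (\<alpha> / 3) * Gamma (1 + \<alpha> / 3))"
proof -
  interpret prob_space M by fact
  note [measurable] = assms(2)
  note pos = assms(3)
  \<comment> \<open>Almost sure positivity extends the tail formula to \<open>x = 0\<close>.\<close>
  have tail: "prob {\<omega> \<in> space M. x < \<xi> \<omega>} = exp (- (x ^ 3) / 6)" if "x \<ge> 0" for x
  proof (cases "x = 0")
    case True
    have "prob {\<omega> \<in> space M. 0 < \<xi> \<omega>} = 1" using pos by (subst prob_Collect_eq_1) auto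
    then show ?thesis using True by simp
  qed (use that assms(4) in auto)
  have le: "prob {\<omega> \<in> space M. \<xi> \<omega> \<le> x} = 1 - exp (- (x ^ 3) / 6)" if "x \<ge> 0" for x
  proof -
    have "{\<omega> \<in> space M. \<xi> \<omega> \<le> x} = space M - {\<omega> \<in> space M. x < \<xi> \<omega>}" by auto
    then show ?thesis using tail[OF that] by (simp add: prob_compl)
  qed
  \<comment> \<open>\<open>c = 1\<close> gives the asserted law of the cube; \<open>c = 6\<close>
    gives the standard exponential law, used for the Gamma integral.\<close>
  have cubed: "distributed M lborel (\<lambda>\<omega>. \<xi> \<omega> ^ 3 / c) (exponential_density (c / 6))" if "c > 0" for c
  proof (rule exponential_distributedI)
    fix a :: real assume "0 \<le> a"
    then have r: "root 3 (c * a) \<ge> 0" "root 3 (c * a) ^ 3 = c * a" using that by simp_all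
    have "\<xi> \<omega> ^ 3 / c \<le> a \<longleftrightarrow> \<xi> \<omega> \<le> root 3 (c * a)" for \<omega>
    proof -
      have "\<xi> \<omega> ^ 3 / c \<le> a \<longleftrightarrow> \<xi> \<omega> ^ 3 \<le> c * a" using that by (simp add: field_simps)
      also have "\<dots> \<longleftrightarrow> root 3 (\<xi> \<omega> ^ 3) \<le> root 3 (c * a)" by simp
      also have "root 3 (\<xi> \<omega> ^ 3) = \<xi> \<omega>" by (rule odd_real_root_power_cancel) simp
      finally show ?thesis .
    qed
    then show "emeasure M {\<omega> \<in> space M. \<xi> \<omega> ^ 3 / c \<le> a} = 1 - ennreal (exp (- a * (c / 6)))"
      using le[OF r(1)] r(2)
      by (simp add: emeasure_eq_measure ennreal_minus mult.commute ennreal_1[symmetric] del: ennreal_1)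
  qed (use that in auto)

  have weak: "weak_conv_m (\<lambda>N. distr (measure_pmf (growing_graph N)) borel (rescaled_xi N)) (distr M borel \<xi>)"
    unfolding weak_conv_m_def weak_conv_def
  proof (intro allI impI)
    fix x :: real
    have cdf: "cdf (distr M borel \<xi>) x = prob {\<omega> \<in> space M. \<xi> \<omega> \<le> x}"
      by (simp add: cdf_def measure_distr vimage_def Int_def conj_commute)
    have cdf': "cdf (distr (measure_pmf (growing_graph N)) borel (rescaled_xi N)) x =
        measure (measure_pmf (growing_graph N)) {h. rescaled_xi N h \<le> x}" for N
      by (simp add: cdf_def measure_distr vimage_def)
    show "(\<lambda>N. cdf (distr (measure_pmf (growing_graph N)) borel (rescaled_xi N)) x) \<longlonglongrightarrow>
        cdf (distr M borel \<xi>) x"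
    \<comment> \<open>The distribution functions converge at every \<open>x\<close>. Right of 0 this
      is the tail limit; elsewhere positivity makes the limit 0, and the terms with
      \<open>N > 0\<close> vanish as well.\<close>
    proof (cases "x > 0")
      case True
      have "measure (measure_pmf (growing_graph N)) {h. rescaled_xi N h \<le> x} =
          1 - measure (measure_pmf (growing_graph N)) {h. x < rescaled_xi N h}" for N
        by (subst measure_pmf.prob_compl[symmetric]) (auto intro!: arg_cong2[where f = measure])
      then show ?thesis
        using rescaled_xi_tail_limit[OF True] le[of x] True
        unfolding cdf cdf' by (auto intro: tendsto_intros)
    next
      case False
      have "prob {\<omega> \<in> space M. \<xi> \<omega> \<le> x} = 0"
        using pos False by (subst prob_Collect_eq_0) (auto elim: eventually_mono)
      moreover have "measure (measure_pmf (growing_graph N)) {h. rescaled_xi N h \<le> x} = 0" if "0 < N" for N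
        using rescaled_xi_pos[OF that] False
        by (force simp: measure_pmf_zero_iff)
      then have "\<forall>\<^sub>F N in sequentially. 0 = measure (measure_pmf (growing_graph N)) {h. rescaled_xi N h \<le> x}"
        by (intro eventually_mono[OF eventually_gt_at_top[of 0]]) simp
      ultimately show ?thesis
        unfolding cdf cdf' by (auto intro: Lim_transform_eventually[OF tendsto_const])
    qed
  qed

  \<comment> \<open>Since \<open>\<xi> ^ 3 / 6\<close> is standard exponential, its power
    \<open>\<alpha> / 3\<close> integrates to a Gamma value. A nonnegative integral yields
    integrability and the value at once.\<close>
  have moment: "(\<integral>\<^sup>+\<omega>. ennreal (\<xi> \<omega> powr \<alpha>) \<partial>M) = ennreal (6 powr (\<alpha> / 3) * Gamma (1 + \<alpha> / 3))"
    if "\<alpha> \<ge> 0" for \<alpha>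
  proof -
    have "(\<integral>\<^sup>+\<omega>. ennreal (\<xi> \<omega> powr \<alpha>) \<partial>M) =
        (\<integral>\<^sup>+\<omega>. ennreal (6 powr (\<alpha> / 3)) * ennreal ((\<xi> \<omega> ^ 3 / 6) powr (\<alpha> / 3)) \<partial>M)"
    proof (rule nn_integral_cong_AE)
      show "AE \<omega> in M. ennreal (\<xi> \<omega> powr \<alpha>) =
          ennreal (6 powr (\<alpha> / 3)) * ennreal ((\<xi> \<omega> ^ 3 / 6) powr (\<alpha> / 3))"
        using pos
      proof eventually_elim
        case (elim \<omega>)
        have "\<xi> \<omega> powr \<alpha> = (\<xi> \<omega> powr 3) powr (\<alpha> / 3)" by (simp add: powr_powr)
        also have "\<dots> = (6 * (\<xi> \<omega> ^ 3 / 6)) powr (\<alpha> / 3)" using elim by simp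
        also have "\<dots> = 6 powr (\<alpha> / 3) * (\<xi> \<omega> ^ 3 / 6) powr (\<alpha> / 3)"
          using elim by (subst powr_mult) auto
        finally show ?case by (simp add: ennreal_mult)
      qed
    qed
    also have "\<dots> = ennreal (6 powr (\<alpha> / 3)) * (\<integral>\<^sup>+\<omega>. ennreal ((\<xi> \<omega> ^ 3 / 6) powr (\<alpha> / 3)) \<partial>M)"
      by (rule nn_integral_cmult) measurable
    also have "(\<integral>\<^sup>+\<omega>. ennreal ((\<xi> \<omega> ^ 3 / 6) powr (\<alpha> / 3)) \<partial>M) =
        (\<integral>\<^sup>+z. ennreal (exponential_density 1 z) * ennreal (z powr (\<alpha> / 3)) \<partial>lborel)"
      using cubed[of 6] by (subst distributed_nn_integral[of M lborel _ "exponential_density 1"]) auto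
    \<comment> \<open>Writing the exponent as \<open>1 + \<alpha> / 3 - 1\<close> exhibits Euler's
      integrand for \<open>Gamma (1 + \<alpha> / 3)\<close>.\<close>
    also have "\<dots> = (\<integral>\<^sup>+z. ennreal (indicator {0..} z * z powr (1 + \<alpha> / 3 - 1) / exp z) \<partial>lborel)"
      by (intro nn_integral_cong)
         (auto simp: exponential_density_def indicator_def exp_minus field_simps simp flip: ennreal_mult)
    also have "\<dots> = ennreal (Gamma (1 + \<alpha> / 3))"
      using that by (intro Gamma_conv_nn_integral_real[symmetric]) simp
    finally show ?thesis using that by (simp add: ennreal_mult Gamma_real_pos less_imp_le)
  qed
  have G: "0 \<le> 6 powr (\<alpha> / 3) * Gamma (1 + \<alpha> / 3)" if "\<alpha> \<ge> 0" for \<alpha> :: real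
    using that by (simp add: Gamma_real_pos less_imp_le)
  have integrable: "integrable M (\<lambda>\<omega>. \<xi> \<omega> powr \<alpha>)" if "\<alpha> \<ge> 0" for \<alpha>
    using moment[OF that] by (intro integrableI_nonneg) auto
  have integral: "expectation (\<lambda>\<omega>. \<xi> \<omega> powr \<alpha>) = 6 powr (\<alpha> / 3) * Gamma (1 + \<alpha> / 3)" if "\<alpha> \<ge> 0" for \<alpha>
    using moment[OF that] G[OF that] by (subst integral_eq_nn_integral) auto

  have scaled: "real N powr (- \<alpha> / 3) * real (xi N h) powr \<alpha> = rescaled_xi N h powr \<alpha>" for N h \<alpha>
    by (simp add: rescaled_xi_def powr_mult powr_powr)
  have conv: "(\<lambda>N. measure_pmf.expectation (growing_graph N) (\<lambda>h. rescaled_xi N h powr \<alpha>))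
      \<longlonglongrightarrow> expectation (\<lambda>\<omega>. \<xi> \<omega> powr \<alpha>)" if "\<alpha> \<ge> 0" for \<alpha>
  \<comment> \<open>The tail formula involves \<open>1 / \<alpha>\<close>, so 0 is treated apart. As
    \<open>0 powr 0 = 0\<close>, positivity of \<open>rescaled_xi\<close> is what makes these
    expectations 1.\<close>
  proof (cases "\<alpha> = 0")
    case True
    have "measure_pmf.expectation (growing_graph N) (\<lambda>h. rescaled_xi N h powr 0) = 1" if "0 < N" for N
    proof -
      have "measure_pmf.expectation (growing_graph N) (\<lambda>h. rescaled_xi N h powr 0) =
          measure_pmf.expectation (growing_graph N) (\<lambda>h. 1)"
        using rescaled_xi_pos[OF that] by (intro integral_cong_AE) (force simp: AE_measure_pmf_iff)+
      then show ?thesis by simp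
    qed
    then have "\<forall>\<^sub>F N in sequentially. 1 = measure_pmf.expectation (growing_graph N) (\<lambda>h. rescaled_xi N h powr \<alpha>)"
      by (intro eventually_mono[OF eventually_gt_at_top[of 0]]) (simp add: True)
    moreover have "expectation (\<lambda>\<omega>. \<xi> \<omega> powr \<alpha>) = 1" using True integral[of 0] by simp
    ultimately show ?thesis by (auto intro: Lim_transform_eventually[OF tendsto_const])
  next
    case False
    with that have a: "\<alpha> > 0" by simp
    \<comment> \<open>The layer-cake formula for \<open>\<xi>\<close> produces the same tail
      integral as the limit in \<open>rescaled_xi_moment\<close>.\<close>
    have "prob {\<omega> \<in> space M. t < \<xi> \<omega> powr \<alpha>} = exp (- ((t powr (1 / \<alpha>)) ^ 3) / 6)" if "t \<ge> 0" for t
    proof -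
      have "prob {\<omega> \<in> space M. t < \<xi> \<omega> powr \<alpha>} = prob {\<omega> \<in> space M. t powr (1 / \<alpha>) < \<xi> \<omega>}"
        using pos by (intro finite_measure_eq_AE) (auto elim!: eventually_mono simp: powr_greater_iff that a)
      then show ?thesis by (simp add: tail)
    qed
    then have "expectation (\<lambda>\<omega>. \<xi> \<omega> powr \<alpha>) =
        (\<integral>t. indicator {0..} t * exp (- ((t powr (1 / \<alpha>)) ^ 3) / 6) \<partial>lborel)"
      by (subst expectation_eq_integral_tail) (auto intro!: Bochner_Integration.integral_cong simp: indicator_def)
    then show ?thesis using rescaled_xi_moment[OF a] by simp
  qed
  show ?thesis
    unfolding scaled
    using weak[unfolded rescaled_xi_def[abs_def]] cubed[of 1] conv integrable integral by simp
qed

end
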